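(* For each nonnegative integer $n$ let $f_n(x)=x^n(1+x)^n$. Then for all integers $n,k$ with $0\le k\le n$, \[ f_k \, f_n^{(n+k)} = \frac{(n+k)!}{(n-k)!}\, f_n^{(n-k)} \] as an identity of functions of $x$.
   Context: Here $f^{(m)}$ denotes the $m$-th derivative of $f$ with respect to $x$ (with $f^{(0)}=f$). *)

theory Defs
  imports "HOL-Analysis.Analysis"
begin

text \<open>The base field is left generic, so that both the real and the complex
  reading of the functions are covered.\<close>

definition f :: "nat \<Rightarrow> 'a::real_normed_field \<Rightarrow> 'a" where
  "f n = (\<lambda>x. x ^ n * (1 + x) ^ n)"

end

theory Submission
  imports Defs
begin

text \<open>The Leibniz rule gives
  \<open>f\<^sub>n\<^bsup>(m)\<^esup> / m! = \<Sum>\<^bsub>i + j = m\<^esub> (n choose i) (n choose j) x\<^bsup>n - i\<^esup> (1 + x)\<^bsup>n - j\<^esup>\<close>.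
  For \<open>m = n + k\<close> the nonzero terms are those with \<open>(i, j) = (k + a, n - a)\<close>, \<open>0 \<le> a \<le> n - k\<close>;
  multiplied by \<open>f\<^sub>k\<close> such a term is exactly the term \<open>(i, j) = (a, n - k - a)\<close> for
  \<open>m = n - k\<close>, since \<open>(n choose (k + a)) = (n choose (n - k - a))\<close>.\<close>

text \<open>Here \<open>w m\<close> plays the role of the m-th derivative divided by
  \<open>fact m\<close>; each differentiation contributes the factor \<open>Suc m\<close> that turns
  \<open>fact m\<close> into \<open>fact (Suc m)\<close>.\<close>

lemma iterated_deriv_eq_fact_mult:
  fixes w :: "nat \<Rightarrow> 'a::real_normed_field \<Rightarrow> 'a"
  assumes "\<And>m x. (w m has_field_derivative of_nat (Suc m) * w (Suc m) x) (at x)"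
  shows "(deriv ^^ m) (w 0) = (\<lambda>x. fact m * w m x)"
proof (induction m)
  case (Suc m)
  have "deriv (\<lambda>x. fact m * w m x) x = fact (Suc m) * w (Suc m) x" for x
    by (rule DERIV_imp_deriv) (auto intro!: derivative_eq_intros assms)
  then show ?case
    by (auto simp: Suc)
qed auto

text \<open>Leibniz rule for derivatives divided by factorials: the binomial weights disappear and
  the product becomes a plain convolution.\<close>

lemma has_field_derivative_convolution:
  fixes u v :: "nat \<Rightarrow> 'a::real_normed_field \<Rightarrow> 'a"
  assumes u: "\<And>i. (u i has_field_derivative of_nat (Suc i) * u (Suc i) x) (at x)"
    and v: "\<And>i. (v i has_field_derivative of_nat (Suc i) * v (Suc i) x) (at x)"
  shows "((\<lambda>x. \<Sum>i\<le>m. u i x * v (m - i) x) has_field_derivative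
           of_nat (Suc m) * (\<Sum>i\<le>Suc m. u i x * v (Suc m - i) x)) (at x)"
proof -
  define t where "t i = u i x * v (Suc m - i) x" for i
  have "((\<lambda>x. \<Sum>i\<le>m. u i x * v (m - i) x) has_field_derivative
      (\<Sum>i\<le>m. of_nat (Suc i) * t (Suc i) + of_nat (Suc m - i) * t i)) (at x)"
    unfolding t_def
    by (rule DERIV_sum) (auto intro!: derivative_eq_intros u v simp: Suc_diff_le algebra_simps)
  \<comment> \<open>Both sums extend to the range up to \<open>Suc m\<close> because the added
    terms, at 0 and at \<open>Suc m\<close> respectively, have weight 0. The weights
    \<open>i\<close> and \<open>Suc m - i\<close> then add up to \<open>Suc m\<close>.\<close>
  also have "(\<Sum>i\<le>m. of_nat (Suc i) * t (Suc i) + of_nat (Suc m - i) * t i)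
      = (\<Sum>i\<le>Suc m. of_nat i * t i) + (\<Sum>i\<le>Suc m. of_nat (Suc m - i) * t i)"
    unfolding sum.distrib by (subst sum.atMost_Suc_shift) simp
  also have "\<dots> = of_nat (Suc m) * (\<Sum>i\<le>Suc m. t i)"
    unfolding sum_distrib_left sum.distrib[symmetric]
    by (rule sum.cong) (auto simp: of_nat_diff algebra_simps)
  finally show ?thesis
    unfolding t_def .
qed

text \<open>For \<open>i \<ge> n\<close> the truncated exponents are harmless: the coefficient
  \<open>n choose Suc i\<close> is 0 and the function differentiated is constant.\<close>

lemma has_field_derivative_binomial_power:
  fixes c x :: "'a::real_normed_field"
  shows "((\<lambda>x. of_nat (n choose i) * (c + x) ^ (n - i)) has_field_derivative
           of_nat (Suc i) * (of_nat (n choose Suc i) * (c + x) ^ (n - Suc i))) (at x)"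
proof -
  have "(n choose i) * (n - i) = Suc i * (n choose Suc i)"
    by (metis binomial_absorb_comp binomial_absorption mult.commute)
  then have "of_nat (n - i) * of_nat (n choose i) = (of_nat (Suc i) * of_nat (n choose Suc i) :: 'a)"
    by (metis of_nat_mult mult.commute)
  then show ?thesis
    by (auto intro!: derivative_eq_intros simp: mult.assoc[symmetric] simp del: of_nat_Suc)
qed

lemma iterated_deriv_f:
  fixes x :: "'a::real_normed_field"
  shows "(deriv ^^ m) (f n) x = fact m *
    (\<Sum>i\<le>m. of_nat (n choose i) * x ^ (n - i) *
      (of_nat (n choose (m - i)) * (1 + x) ^ (n - (m - i))))"
proof -
  \<comment> \<open>The values \<open>c = 0\<close> and \<open>c = 1\<close> give the two factors of
    \<open>f n\<close>.\<close>
  define u where "u c i x = of_nat (n choose i) * (c + x) ^ (n - i)" for c i and x :: 'a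
  define w where "w m x = (\<Sum>i\<le>m. u 0 i x * u 1 (m - i) x)" for m x
  have "(w m has_field_derivative of_nat (Suc m) * w (Suc m) x) (at x)" for m x
    unfolding w_def
    by (rule has_field_derivative_convolution; unfold u_def;
        rule has_field_derivative_binomial_power)
  from iterated_deriv_eq_fact_mult[of w, OF this]
  have "(deriv ^^ m) (w 0) x = fact m * w m x"
    by simp
  moreover have "w 0 = f n"
    by (auto simp: w_def u_def f_def)
  ultimately show ?thesis
    by (simp add: w_def u_def)
qed

theorem corollary4p3:
  fixes n k :: nat
  assumes "k \<le> n"
  shows "(\<lambda>x::'a::real_normed_field. f k x * (deriv ^^ (n + k)) (f n) x) =
         (\<lambda>x. fact (n + k) / fact (n - k) * (deriv ^^ (n - k)) (f n) x)"
proof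
  fix x :: 'a
  define t where "t m i = of_nat (n choose i) * x ^ (n - i) *
    (of_nat (n choose (m - i)) * (1 + x) ^ (n - (m - i)))" for m i
  have "(\<Sum>i\<le>n + k. t (n + k) i) = (\<Sum>i\<in>{k..n}. t (n + k) i)"
  proof (rule sum.mono_neutral_right)
    \<comment> \<open>For \<open>i < k\<close> the second binomial coefficient vanishes, for
      \<open>i > n\<close> the first.\<close>
    show "\<forall>i\<in>{..n + k} - {k..n}. t (n + k) i = 0"
      by (auto simp: t_def not_le binomial_eq_0)
  qed auto
  also have "\<dots> = (\<Sum>a\<le>n - k. t (n + k) (a + k))"
    using assms by (intro sum.reindex_bij_witness[of _ "\<lambda>a. a + k" "\<lambda>i. i - k"]) auto
  finally have "f k x * (\<Sum>i\<le>n + k. t (n + k) i) = (\<Sum>a\<le>n - k. f k x * t (n + k) (a + k))"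
    by (simp add: sum_distrib_left)
  also have "\<dots> = (\<Sum>a\<le>n - k. t (n - k) a)"
  proof (rule sum.cong)
    fix a assume "a \<in> {..n - k}"
    with assms have a: "a + k \<le> n"
      by auto
    then have [simp]: "n + k - (a + k) = n - a" "n - (n - a) = a" "n - (n - (k + a)) = k + a"
      by auto
    \<comment> \<open>By symmetry the two binomial coefficients trade places between the
      factors.\<close>
    have "n choose (a + k) = n choose (n - k - a)" "n choose (n - a) = n choose a"
      using a binomial_symmetric[of "a + k" n] binomial_symmetric[of a n]
      by (auto simp: add.commute)
    moreover have "x ^ (n - a) = x ^ k * x ^ (n - (a + k))"
      using a by (simp flip: power_add)
    ultimately show "f k x * t (n + k) (a + k) = t (n - k) a"
      by (simp add: f_def t_def power_add)
  qed simp
  finally show "f k x * (deriv ^^ (n + k)) (f n) x =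
      fact (n + k) / fact (n - k) * (deriv ^^ (n - k)) (f n) x"
    unfolding iterated_deriv_f t_def[symmetric] by (simp add: mult.left_commute)
qed

end
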